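(* Let $H$ be a finite dimensional Hilbert space and let $\mathcal K$ be a symmetric mapping cone on $B(H)$. Then its dual cone $\mathcal K^\circ$ is also a symmetric mapping cone.
   Context: $H$ is a finite dimensional complex Hilbert space with a fixed orthonormal basis, $(e_{ij})$ are the corresponding matrix units of $B(H)$, $t$ (also written $x\mapsto x^t$) is the transpose map on $B(H)$ with respect to this basis, and $Tr$ is the usual trace. $P(H)$ is the cone of positive linear maps $B(H)\to B(H)$ and $CP(H)\subset P(H)$ the cone of completely positive maps. Cones are convex. A mapping cone (on $B(H)$) is a nonzero closed subcone $\mathcal K$ of $P(H)$ such that for all $\phi\in\mathcal K$ and $\alpha,\beta\in CP(H)$ we have $\alpha\circ\phi\in\mathcal K$ and $\phi\circ\beta\in\mathcal K$. For $\phi\in P(H)$, $\phi^*$ is the adjoint map defined by $Tr(\phi(a)b)=Tr(a\phi^*(b))$ for all $a,b\in B(H)$, and $\phi^t=t\circ\phi\circ t$. A mapping cone $\mathcal K$ is symmetric if for every $\phi\in P(H)$: $\phi\in\mathcal K \Leftrightarrow \phi^*\in\mathcal K\Leftrightarrow \phi^t\in\mathcal K$. The Choi matrix of a linear map $\phi:B(H)\to B(H)$ is $C_\phi=\sum_{i,j}e_{ij}\otimes\phi(e_{ij})\in B(H)\otimes B(H)=B(H\otimes H)$. The dual cone of $\mathcal K$ is $\mathcal K^\circ=\{\phi\in P(H): Tr(C_\phi C_\alpha)\ge 0\ \ \forall\,\alpha\in\mathcal K\}$. *)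

theory Defs
  imports "HOL-Analysis.Analysis" "HOL-Library.Complex_Order"
begin

text \<open>
  \<open>H\<close> is \<open>complex ^ 'n\<close> with its standard basis as the fixed orthonormal basis, and
  \<open>B(H)\<close> is the type \<open>complex ^ 'n ^ 'n\<close> of square matrices, so that the map \<open>t\<close> is
  \<^const>\<open>transpose\<close> and \<open>Tr\<close> is \<^const>\<open>trace\<close>. The order on \<^typ>\<open>complex\<close> is the one for
  which \<open>0 \<le> z\<close> says that \<open>z\<close> is real and nonnegative.
\<close>

type_synonym 'n op = "complex ^ 'n ^ 'n"

definition cinner :: "complex ^ 'n \<Rightarrow> complex ^ 'n::finite \<Rightarrow> complex" where
  "cinner v w = (\<Sum>i\<in>UNIV. cnj (v $ i) * w $ i)"

definition positive_op :: "'n::finite op \<Rightarrow> bool" where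
  "positive_op A \<longleftrightarrow> (\<forall>v. 0 \<le> cinner v (A *v v))"

definition op_scale :: "complex \<Rightarrow> 'n::finite op \<Rightarrow> 'n op" where
  "op_scale c A = (\<chi> i j. c * A $ i $ j)"

abbreviation op_linear :: "('n::finite op \<Rightarrow> 'n op) \<Rightarrow> bool" where
  "op_linear \<equiv> Vector_Spaces.linear op_scale op_scale"

definition positive_maps :: "('n::finite op \<Rightarrow> 'n op) set" where
  "positive_maps = {\<phi>. op_linear \<phi> \<and> (\<forall>A. positive_op A \<longrightarrow> positive_op (\<phi> A))}"

text \<open>
  An operator on \<open>\<complex>\<^sup>k \<otimes> H\<close> is given by its blocks \<open>A i j\<close> in \<open>B(H)\<close>, \<open>i, j < k\<close>, and a vector
  by its components \<open>v i\<close> in \<open>H\<close>, \<open>i < k\<close>; values at other indices play no role. The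
  map \<open>id\<^sub>k \<otimes> \<phi>\<close> acts by applying \<open>\<phi>\<close> to every block.
\<close>

definition positive_block_op :: "nat \<Rightarrow> (nat \<Rightarrow> nat \<Rightarrow> 'n::finite op) \<Rightarrow> bool" where
  "positive_block_op k A \<longleftrightarrow>
     (\<forall>v. 0 \<le> (\<Sum>i<k. \<Sum>j<k. cinner (v i) (A i j *v v j)))"

definition cp_maps :: "('n::finite op \<Rightarrow> 'n op) set" where
  "cp_maps = {\<phi>. op_linear \<phi> \<and>
     (\<forall>k A. positive_block_op k A \<longrightarrow> positive_block_op k (\<lambda>i j. \<phi> (A i j)))}"

definition matrix_unit :: "'n \<Rightarrow> 'n \<Rightarrow> 'n::finite op" where
  "matrix_unit i j = (\<chi> k l. if k = i \<and> l = j then 1 else 0)"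

lemma matrix_unit_expansion:
  "a = (\<Sum>k\<in>UNIV. \<Sum>l\<in>UNIV. op_scale (a $ k $ l) (matrix_unit k l))"
proof -
  have "(\<Sum>k\<in>UNIV. \<Sum>l\<in>UNIV. op_scale (a $ k $ l) (matrix_unit k l)) $ i $ j = a $ i $ j"
    for i j
  proof -
    have "(\<Sum>k\<in>UNIV. \<Sum>l\<in>UNIV. op_scale (a $ k $ l) (matrix_unit k l)) $ i $ j =
        (\<Sum>k\<in>UNIV. \<Sum>l\<in>UNIV. if l = j then if k = i then a $ k $ l else 0 else 0)"
      unfolding sum_component by (intro sum.cong refl) (simp add: op_scale_def matrix_unit_def)
    then show ?thesis by simp
  qed
  then show ?thesis by (simp add: vec_eq_iff)
qed

lemma trace_mult: "trace (a ** b) = (\<Sum>k\<in>UNIV. \<Sum>l\<in>UNIV. a $ k $ l * b $ l $ k)"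
  by (simp add: trace_def matrix_matrix_mult_def)

lemma trace_matrix_unit_mult: "trace (matrix_unit k l ** b) = b $ l $ k"
proof -
  have "trace (matrix_unit k l ** b) =
      (\<Sum>i\<in>UNIV. if i = k then \<Sum>j\<in>UNIV. if j = l then b $ j $ i else 0 else 0)"
    unfolding trace_mult matrix_unit_def
    by (intro sum.cong refl) (simp add: if_distrib[of "\<lambda>x. x * _"] cong: if_cong)
  then show ?thesis by simp
qed

lemma trace_mult_sum_scale:
  "trace ((\<Sum>k\<in>UNIV. \<Sum>l\<in>UNIV. op_scale (c k l) (f k l)) ** b) =
   (\<Sum>k\<in>(UNIV::'a::finite set). \<Sum>l\<in>(UNIV::'b::finite set). c k l * trace (f k l ** b))"
proof -
  interpret additive "\<lambda>a. trace (a ** b)"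
    by standard (simp add: trace_mult distrib_right sum.distrib)
  show ?thesis
    by (simp add: sum) (simp add: trace_mult op_scale_def sum_distrib_left mult.assoc)
qed

lemma ex1_adj_map:
  assumes "op_linear \<phi>"
  shows "\<exists>!\<psi>. \<forall>a b. trace (\<phi> a ** b) = trace (a ** \<psi> b)"
proof (rule ex_ex1I)
  interpret Vector_Spaces.linear op_scale op_scale \<phi> by fact
  let ?\<psi> = "\<lambda>b. \<chi> l k. trace (\<phi> (matrix_unit k l) ** b)"
  have "trace (\<phi> a ** b) = trace (a ** ?\<psi> b)" for a b
  proof -
    have "\<phi> a = (\<Sum>k\<in>UNIV. \<Sum>l\<in>UNIV. op_scale (a $ k $ l) (\<phi> (matrix_unit k l)))"
      by (subst matrix_unit_expansion[of a]) (simp add: sum scale)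
    then show ?thesis
      by (simp add: trace_mult_sum_scale) (simp add: trace_mult)
  qed
  then show "\<exists>\<psi>. \<forall>a b. trace (\<phi> a ** b) = trace (a ** \<psi> b)" by (intro exI[of _ ?\<psi>] allI)
next
  fix \<psi> \<psi>'
  assume "\<forall>a b. trace (\<phi> a ** b) = trace (a ** \<psi> b)"
    and "\<forall>a b. trace (\<phi> a ** b) = trace (a ** \<psi>' b)"
  then have "trace (matrix_unit k l ** \<psi> b) = trace (matrix_unit k l ** \<psi>' b)" for k l b
    by metis
  then show "\<psi> = \<psi>'"
    by (simp add: trace_matrix_unit_mult fun_eq_iff vec_eq_iff)
qed

definition adj_map :: "('n::finite op \<Rightarrow> 'n op) \<Rightarrow> 'n op \<Rightarrow> 'n op" where
  "adj_map \<phi> = (THE \<psi>. \<forall>a b. trace (\<phi> a ** b) = trace (a ** \<psi> b))"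

lemma trace_adj_map:
  assumes "op_linear \<phi>"
  shows "trace (\<phi> a ** b) = trace (a ** adj_map \<phi> b)"
  using theI'[OF ex1_adj_map[OF assms]] unfolding adj_map_def by blast

definition transpose_map :: "('n::finite op \<Rightarrow> 'n op) \<Rightarrow> 'n op \<Rightarrow> 'n op" where
  "transpose_map \<phi> = transpose \<circ> \<phi> \<circ> transpose"

text \<open>
  In the next definition \<^const>\<open>closed\<close> refers to the topology of pointwise convergence on
  functions. On the space of linear maps, which is finite-dimensional and contains
  \<^const>\<open>positive_maps\<close>, this is the usual norm topology, and linear maps form a closed set.
\<close>

definition closed_subcone :: "('n::finite op \<Rightarrow> 'n op) set \<Rightarrow> bool" where
  "closed_subcone K \<longleftrightarrow>
     K \<subseteq> positive_maps \<and> closed K \<and>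
     (\<forall>\<phi>\<in>K. \<forall>\<psi>\<in>K. (\<lambda>a. \<phi> a + \<psi> a) \<in> K) \<and>
     (\<forall>\<phi>\<in>K. \<forall>c::real. 0 \<le> c \<longrightarrow> (\<lambda>a. c *\<^sub>R \<phi> a) \<in> K)"

definition mapping_cone :: "('n::finite op \<Rightarrow> 'n op) set \<Rightarrow> bool" where
  "mapping_cone K \<longleftrightarrow>
     closed_subcone K \<and> (\<exists>\<phi>\<in>K. \<phi> \<noteq> (\<lambda>a. 0)) \<and>
     (\<forall>\<phi>\<in>K. \<forall>\<alpha>\<in>cp_maps. \<forall>\<beta>\<in>cp_maps. \<alpha> \<circ> \<phi> \<in> K \<and> \<phi> \<circ> \<beta> \<in> K)"

definition symmetric_mapping_cone :: "('n::finite op \<Rightarrow> 'n op) set \<Rightarrow> bool" where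
  "symmetric_mapping_cone K \<longleftrightarrow>
     mapping_cone K \<and>
     (\<forall>\<phi>\<in>positive_maps. (\<phi> \<in> K \<longleftrightarrow> adj_map \<phi> \<in> K) \<and> (\<phi> \<in> K \<longleftrightarrow> transpose_map \<phi> \<in> K))"

definition tensor_op :: "'m::finite op \<Rightarrow> 'n::finite op \<Rightarrow> ('m \<times> 'n) op" where
  "tensor_op A B = (\<chi> p q. A $ fst p $ fst q * B $ snd p $ snd q)"

definition choi_matrix :: "('n::finite op \<Rightarrow> 'n op) \<Rightarrow> ('n \<times> 'n) op" where
  "choi_matrix \<phi> = (\<Sum>i\<in>UNIV. \<Sum>j\<in>UNIV. tensor_op (matrix_unit i j) (\<phi> (matrix_unit i j)))"

definition dual_cone :: "('n::finite op \<Rightarrow> 'n op) set \<Rightarrow> ('n op \<Rightarrow> 'n op) set" where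
  "dual_cone K =
     {\<phi> \<in> positive_maps. \<forall>\<alpha>\<in>K. 0 \<le> trace (choi_matrix \<phi> ** choi_matrix \<alpha>)}"

end

theory Submission
  imports Defs
begin

text \<open>
  The pairing \<open>\<langle>\<phi>, \<psi>\<rangle> = Tr (C\<^sub>\<phi> C\<^sub>\<psi>)\<close> satisfies \<open>\<langle>\<phi>\<^sup>*, \<psi>\<rangle> = \<langle>\<phi>, \<psi>\<^sup>*\<rangle>\<close>,
  \<open>\<langle>\<phi>\<^sup>t, \<psi>\<rangle> = \<langle>\<phi>, \<psi>\<^sup>t\<rangle>\<close> and \<open>\<langle>\<alpha> \<circ> \<phi>, \<psi>\<rangle> = \<langle>\<phi>, \<alpha>\<^sup>* \<circ> \<psi>\<rangle>\<close>. Since the adjoint of a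
  (completely) positive map is (completely) positive, the dual cone inherits symmetry and
  invariance under left composition from the cone; invariance under right composition follows
  by taking adjoints. The map \<open>a \<mapsto> Tr(a) 1\<close> is a nonzero element, as its pairing with \<open>\<psi>\<close>
  is \<open>Tr (\<psi>(1))\<close>.
\<close>

section \<open>Positive semidefinite kernels\<close>

text \<open>Positivity relative to an arbitrary index set permits induction on that set, and index
  pairs \<open>(i, a)\<close> let it cover block operators of every size \<open>k\<close>.\<close>

definition psd_on :: "'i set \<Rightarrow> ('i \<Rightarrow> 'i \<Rightarrow> complex) \<Rightarrow> bool" where
  "psd_on I A \<longleftrightarrow> (\<forall>v. 0 \<le> (\<Sum>i\<in>I. \<Sum>j\<in>I. cnj (v i) * A i j * v j))"

lemma psd_on_subset:
  fixes A :: "'i \<Rightarrow> 'i \<Rightarrow> complex"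
  assumes "psd_on I A" "J \<subseteq> I" "finite I"
  shows "psd_on J A"
  unfolding psd_on_def
proof
  fix v :: "'i \<Rightarrow> complex"
  let ?w = "\<lambda>i. if i \<in> J then v i else 0"
  have "(\<Sum>i\<in>J. \<Sum>j\<in>J. cnj (v i) * A i j * v j) = (\<Sum>i\<in>I. \<Sum>j\<in>I. cnj (?w i) * A i j * ?w j)"
  proof (rule sum.mono_neutral_cong_left)
    show "(\<Sum>j\<in>J. cnj (v i) * A i j * v j) = (\<Sum>j\<in>I. cnj (?w i) * A i j * ?w j)" if "i \<in> J" for i
      by (rule sum.mono_neutral_cong_left) (use assms that in auto)
  qed (use assms in auto)
  then show "0 \<le> (\<Sum>i\<in>J. \<Sum>j\<in>J. cnj (v i) * A i j * v j)"
    using assms(1) by (simp add: psd_on_def)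
qed

lemma psd_on_diag:
  assumes "psd_on I A" "finite I" "a \<in> I"
  shows "0 \<le> A a a"
proof -
  have "psd_on {a} A" using assms psd_on_subset by blast
  then show ?thesis unfolding psd_on_def by (auto dest: spec[of _ "\<lambda>_. 1"])
qed

lemma psd_on_pair:
  assumes "psd_on I A" "finite I" "a \<in> I" "b \<in> I" "a \<noteq> b"
  shows "0 \<le> cnj x * A a a * x + cnj x * A a b * y + (cnj y * A b a * x + cnj y * A b b * y)"
proof -
  have "psd_on {a, b} A" using assms psd_on_subset[of I A "{a, b}"] by blast
  then show ?thesis unfolding psd_on_def
    using assms(5) by (auto dest!: spec[of _ "\<lambda>i. if i = a then x else y"])
qed

lemma psd_on_hermitian:
  assumes "psd_on I A" "finite I" "a \<in> I" "b \<in> I"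
  shows "A b a = cnj (A a b)"
proof (cases "a = b")
  case True
  then show ?thesis using psd_on_diag[OF assms(1-3)] by (simp add: complex_eq_iff less_eq_complex_def)
next
  case False
  note P = psd_on_pair[OF assms False]
  show ?thesis
    \<comment> \<open>The form is real. At \<open>(1, 1)\<close> this makes the imaginary parts of
      \<open>A a b\<close> and \<open>A b a\<close> opposite, at \<open>(1, \<i>)\<close> it makes
      their real parts equal.\<close>
    using P[of 1 1] P[of 1 \<i>] psd_on_diag[OF assms(1,2,3)] psd_on_diag[OF assms(1,2,4)]
    by (simp add: complex_eq_iff less_eq_complex_def)
qed

text \<open>With \<open>A b b = 0\<close>, the form at \<open>(1, - s * cnj (A a b))\<close> is
  affine in the real number \<open>s\<close> with slope \<open>- 2 * N\<close>. For
  \<open>N > 0\<close> it would become negative; \<open>s * N = Re (A a a) + 1\<close> is already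
  large enough.\<close>

lemma psd_on_zero_diag:
  assumes "psd_on I A" "finite I" "a \<in> I" "b \<in> I" "A b b = 0"
  shows "A a b = 0"
proof (cases "a = b")
  case False
  show ?thesis
  proof (rule ccontr)
    assume nz: "A a b \<noteq> 0"
    define N where "N = (cmod (A a b))\<^sup>2"
    define s where "s = (Re (A a a) + 1) / N"
    have N: "N > 0" using nz by (simp add: N_def)
    have h: "A b a = cnj (A a b)" by (rule psd_on_hermitian[OF assms(1-4)])
    have c: "A a b * cnj (A a b) = of_real N" by (simp only: N_def complex_norm_square)
    have "0 \<le> A a a + A a b * (- of_real s * cnj (A a b)) + cnj (- of_real s * cnj (A a b)) * A b a"
      using psd_on_pair[OF assms(1-4) False, of 1 "- of_real s * cnj (A a b)"] assms(5) by simp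
    also have "\<dots> = A a a - of_real (2 * s) * (A a b * cnj (A a b))"
      by (simp add: h algebra_simps)
    also have "\<dots> = A a a - of_real (2 * s * N)" unfolding c by simp
    finally have "2 * (s * N) \<le> Re (A a a)" by (simp add: less_eq_complex_def)
    then show False using N psd_on_diag[OF assms(1-3)]
      by (simp add: s_def less_eq_complex_def)
  qed
qed (use assms in simp)

text \<open>Completing the square: the form of the complement at \<open>v\<close> is the form of
  \<open>A\<close> at an extension of \<open>v\<close> to \<open>a\<close>. If
  \<open>A a a = 0\<close>, the quotient is \<open>0\<close> and the kernel is just \<open>A\<close>
  on \<open>I\<close>.\<close>

lemma psd_on_schur_complement:
  fixes A :: "'i \<Rightarrow> 'i \<Rightarrow> complex"
  assumes "psd_on (insert a I) A" "finite I" "a \<notin> I"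
  shows "psd_on I (\<lambda>i j. A i j - A i a * A a j / A a a)"
proof (cases "A a a = 0")
  case True
  then show ?thesis using psd_on_subset[OF assms(1), of I] assms(2) by auto
next
  case False
  show ?thesis unfolding psd_on_def
  proof
    fix v :: "'i \<Rightarrow> complex"
    define S where "S = (\<Sum>j\<in>I. A a j * v j)"
    \<comment> \<open>The new coordinate solves \<open>A a a * w a + S = 0\<close>, so that row
      \<open>a\<close> contributes nothing.\<close>
    define w where "w = v(a := - S / A a a)"
    have w: "w i = v i" if "i \<in> I" for i using that assms(3) by (auto simp: w_def)
    have wa: "w a = - S / A a a" by (simp add: w_def)
    have S: "(\<Sum>j\<in>I. A a j * w j) = S" unfolding S_def by (intro sum.cong) (simp_all add: w)
    have "0 \<le> (\<Sum>i\<in>insert a I. \<Sum>j\<in>insert a I. cnj (w i) * A i j * w j)"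
      using assms(1) by (simp add: psd_on_def)
    also have "\<dots> = cnj (w a) * (A a a * w a + (\<Sum>j\<in>I. A a j * w j)) +
        (\<Sum>i\<in>I. cnj (w i) * A i a * w a + (\<Sum>j\<in>I. cnj (w i) * A i j * w j))"
      using assms(2,3) by (simp add: sum_distrib_left algebra_simps)
    also have "\<dots> = (\<Sum>i\<in>I. cnj (v i) * A i a * w a + (\<Sum>j\<in>I. cnj (v i) * A i j * v j))"
      using False by (simp add: S_def[symmetric] wa w)
    also have "\<dots> = (\<Sum>i\<in>I. \<Sum>j\<in>I. cnj (v i) * (A i j - A i a * A a j / A a a) * v j)"
    proof (rule sum.cong[OF refl])
      fix i
      have "cnj (v i) * A i a * w a = (\<Sum>j\<in>I. - (cnj (v i) * (A i a * A a j / A a a) * v j))"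
        by (simp add: wa S_def sum_distrib_left sum_divide_distrib sum_negf mult.assoc)
      then show "cnj (v i) * A i a * w a + (\<Sum>j\<in>I. cnj (v i) * A i j * v j) =
          (\<Sum>j\<in>I. cnj (v i) * (A i j - A i a * A a j / A a a) * v j)"
        by (simp add: sum.distrib[symmetric] algebra_simps)
    qed
    finally show "0 \<le> (\<Sum>i\<in>I. \<Sum>j\<in>I. cnj (v i) * (A i j - A i a * A a j / A a a) * v j)" .
  qed
qed

text \<open>
  Splitting off the rank-one kernel \<open>A i a * A a j / A a a\<close>, which agrees with \<open>A\<close> in row and
  column \<open>a\<close>, leaves a positive semidefinite kernel on a smaller set. If \<open>A a a = 0\<close>, that row
  and column vanish, so the junk value \<open>0\<close> of the quotient is the right one.
\<close>

lemma psd_on_trace_mult_nonneg: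
  assumes "finite I" "psd_on I A" "psd_on I B"
  shows "0 \<le> (\<Sum>i\<in>I. \<Sum>j\<in>I. A i j * B j i)"
  using assms
proof (induction I arbitrary: A rule: finite_induct)
  case (insert a I)
  let ?J = "insert a I"
  note fin = finite.insertI[OF \<open>finite I\<close>, of a]
  define A' where "A' = (\<lambda>i j. A i j - A i a * A a j / A a a)"
  have zero: "A' i a = 0" "A' a i = 0" if "i \<in> ?J" for i
    using psd_on_zero_diag[OF insert.prems(1) fin that, of a]
      psd_on_hermitian[OF insert.prems(1) fin that, of a]
    by (auto simp: A'_def)
  have "0 \<le> (\<Sum>i\<in>I. \<Sum>j\<in>I. A' i j * B j i)"
    unfolding A'_def
    by (intro insert.IH psd_on_schur_complement insert psd_on_subset[OF insert.prems(2)]) (use fin in auto)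
  also have "\<dots> = (\<Sum>i\<in>?J. \<Sum>j\<in>?J. A' i j * B j i)"
    using insert.hyps by (simp add: zero)
  finally have 1: "0 \<le> (\<Sum>i\<in>?J. \<Sum>j\<in>?J. A' i j * B j i)" .
  \<comment> \<open>The form of \<open>B\<close> at column \<open>a\<close> of \<open>A\<close>. As
    \<open>cnj (A j a) = A a j\<close>, this is the pairing of \<open>B\<close> with the rank-one
    part, up to the factor \<open>A a a\<close>.\<close>
  have "0 \<le> (\<Sum>j\<in>?J. \<Sum>i\<in>?J. cnj (A j a) * B j i * A i a)"
    using insert.prems(2) by (simp add: psd_on_def)
  also have "\<dots> = (\<Sum>j\<in>?J. \<Sum>i\<in>?J. A i a * A a j * B j i)"
    by (intro sum.cong refl) (simp add: psd_on_hermitian[OF insert.prems(1) fin, of _ a])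
  also have "\<dots> = (\<Sum>i\<in>?J. \<Sum>j\<in>?J. A i a * A a j * B j i)" by (rule sum.swap)
  finally have 2: "0 \<le> (\<Sum>i\<in>?J. \<Sum>j\<in>?J. A i a * A a j * B j i)" .
  have "0 \<le> (\<Sum>i\<in>?J. \<Sum>j\<in>?J. A i a * A a j * B j i) / A a a"
    using 2 psd_on_diag[OF insert.prems(1) fin, of a]
    by (auto simp: less_eq_complex_def complex_is_Real_iff Re_divide Im_divide)
  then have "0 \<le> (\<Sum>i\<in>?J. \<Sum>j\<in>?J. A' i j * B j i) + (\<Sum>i\<in>?J. \<Sum>j\<in>?J. A i a * A a j * B j i) / A a a"
    using 1 by simp
  also have "\<dots> = (\<Sum>i\<in>?J. \<Sum>j\<in>?J. A i j * B j i)"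
    unfolding sum_divide_distrib sum.distrib[symmetric]
    by (intro sum.cong refl) (simp add: A'_def algebra_simps)
  finally show ?case .
qed simp

section \<open>Positive operators and block operators\<close>

lemma cinner_matrix_vector:
  "cinner v (A *v w) = (\<Sum>i\<in>UNIV. \<Sum>j\<in>UNIV. cnj (v $ i) * A $ i $ j * w $ j)"
  by (simp add: cinner_def matrix_vector_mult_def sum_distrib_left mult.assoc)

lemma positive_op_iff_block: "positive_op A \<longleftrightarrow> positive_block_op 1 (\<lambda>_ _. A)"
  unfolding positive_op_def positive_block_op_def
  by (auto dest: spec[of _ "\<lambda>_. v" for v])

lemma psd_on_block:
  assumes "positive_block_op k A"
  shows "psd_on ({..<k} \<times> UNIV) (\<lambda>p q. A (fst p) (fst q) $ snd p $ snd q)"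
  unfolding psd_on_def
proof
  fix v :: "nat \<times> 'a \<Rightarrow> complex"
  have "0 \<le> (\<Sum>i<k. \<Sum>j<k. cinner (\<chi> a. v (i, a)) (A i j *v (\<chi> a. v (j, a))))"
    using assms unfolding positive_block_op_def by (rule spec[of _ "\<lambda>i. \<chi> a. v (i, a)"])
  also have "\<dots> = (\<Sum>i<k. \<Sum>a\<in>UNIV. \<Sum>j<k. \<Sum>b\<in>UNIV. cnj (v (i, a)) * A i j $ a $ b * v (j, b))"
    by (simp add: cinner_matrix_vector) (intro sum.cong refl sum.swap)
  finally show "0 \<le> (\<Sum>p\<in>{..<k} \<times> UNIV. \<Sum>q\<in>{..<k} \<times> UNIV.
      cnj (v p) * A (fst p) (fst q) $ snd p $ snd q * v q)"
    by (simp add: sum.cartesian_product')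
qed

text \<open>The sum is the trace of the product of two positive operators on C^k tensor H;
  flattening the blocks reduces this to scalar kernels.\<close>

lemma block_trace_mult_nonneg:
  assumes "positive_block_op k A" "positive_block_op k B"
  shows "0 \<le> (\<Sum>i<k. \<Sum>j<k. trace (A i j ** B j i))"
proof -
  have "(\<Sum>i<k. \<Sum>j<k. trace (A i j ** B j i)) =
      (\<Sum>i<k. \<Sum>a\<in>UNIV. \<Sum>j<k. \<Sum>b\<in>UNIV. A i j $ a $ b * B j i $ b $ a)"
    by (simp add: trace_mult) (intro sum.cong refl sum.swap)
  then show ?thesis
    using psd_on_trace_mult_nonneg[OF _ psd_on_block[OF assms(1)] psd_on_block[OF assms(2)]]
    by (simp add: sum.cartesian_product')
qed

text \<open>In Dirac notation, |v><w|.\<close>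

definition rank_one_op :: "complex ^ 'n \<Rightarrow> complex ^ 'n \<Rightarrow> 'n::finite op" where
  "rank_one_op v w = (\<chi> a b. v $ a * cnj (w $ b))"

text \<open>Writing quadratic forms as traces allows a map to be moved across them by its
  adjoint.\<close>

lemma trace_mult_rank_one: "trace (A ** rank_one_op w v) = cinner v (A *v w)"
  by (simp add: trace_mult cinner_matrix_vector rank_one_op_def mult_ac)

lemma cinner_rank_one: "cinner x (rank_one_op v w *v y) = cinner x v * cnj (cinner y w)"
  by (simp add: cinner_matrix_vector) (simp add: rank_one_op_def cinner_def sum_product mult_ac)

text \<open>The blocks are those of |v><v| for the vector of C^k tensor H with components
  \<open>v i\<close>, so the form at \<open>w\<close> is the squared modulus of an inner
  product.\<close>

lemma positive_block_rank_one: "positive_block_op k (\<lambda>i j. rank_one_op (v i) (v j))"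
proof -
  have "(\<Sum>i<k. \<Sum>j<k. cinner (w i) (rank_one_op (v i) (v j) *v w j)) =
      (\<Sum>i<k. cinner (w i) (v i)) * cnj (\<Sum>i<k. cinner (w i) (v i))" for w
    by (simp add: cinner_rank_one sum_product)
  also have "0 \<le> (\<dots> w)" for w
    unfolding complex_norm_square[symmetric] by (simp add: less_eq_complex_def)
  finally show ?thesis by (simp add: positive_block_op_def)
qed

lemma trace_nonneg:
  assumes "positive_op A"
  shows "0 \<le> trace A"
proof -
  have "cinner (axis i 1) (A *v axis i 1) = A $ i $ i" for i
    by (simp add: cinner_matrix_vector axis_def if_distrib[of cnj] if_distrib[of "\<lambda>x. x * _"]
        if_distrib[of "\<lambda>x. _ * x"] cong: if_cong)
  then have "0 \<le> A $ i $ i" for i using assms unfolding positive_op_def by metis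
  then show ?thesis by (simp add: trace_def sum_nonneg)
qed

lemma positive_op_transpose:
  assumes "positive_op A"
  shows "positive_op (transpose A)"
proof -
  have "cinner v (transpose A *v v) = cinner (\<chi> i. cnj (v $ i)) (A *v (\<chi> i. cnj (v $ i)))" for v
    by (simp add: cinner_matrix_vector transpose_def)
      (subst sum.swap, simp add: mult_ac)
  then show ?thesis using assms by (simp add: positive_op_def)
qed

lemma positive_op_mat: "positive_op (mat 1)"
  by (auto simp: positive_op_def cinner_def intro!: sum_nonneg)
    (simp add: less_eq_complex_def)

section \<open>Adjoint and transposed maps\<close>

lemma vector_space_op_scale: "vector_space (op_scale :: complex \<Rightarrow> 'n::finite op \<Rightarrow> 'n op)"
  by standard (simp_all add: op_scale_def vec_eq_iff algebra_simps)

lemma op_linear_iff: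
  "op_linear \<phi> \<longleftrightarrow> (\<forall>a b. \<phi> (a + b) = \<phi> a + \<phi> b) \<and> (\<forall>c a. \<phi> (op_scale c a) = op_scale c (\<phi> a))"
  by (simp add: Vector_Spaces.linear_def vector_space_op_scale module_hom_def module_hom_axioms_def
      vector_space_op_scale[unfolded vector_space_def module_iff_vector_space[symmetric]]
      module_iff_vector_space)

lemma trace_mult_add_right: "trace (a ** (b + c)) = trace (a ** b) + trace (a ** (c :: 'n::finite op))"
  by (simp add: trace_mult distrib_left sum.distrib)

lemma trace_mult_scale_right: "trace (a ** op_scale c b) = c * trace (a ** b)"
  by (simp add: trace_mult op_scale_def sum_distrib_left mult_ac)

lemma trace_mult_eqI:
  fixes b c :: "'n::finite op"
  assumes "\<And>a. trace (a ** b) = trace (a ** c)"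
  shows "b = c"
  by (simp add: vec_eq_iff) (metis assms trace_matrix_unit_mult)

lemma adj_mapI:
  assumes "op_linear \<phi>" "\<And>a b. trace (\<phi> a ** b) = trace (a ** \<psi> b)"
  shows "adj_map \<phi> = \<psi>"
proof
  show "adj_map \<phi> b = \<psi> b" for b
    by (rule trace_mult_eqI) (metis assms trace_adj_map)
qed

lemma op_linear_adj_map:
  assumes "op_linear \<phi>"
  shows "op_linear (adj_map \<phi>)"
  unfolding op_linear_iff
  by (auto intro!: trace_mult_eqI
      simp: trace_adj_map[OF assms, symmetric] trace_mult_add_right trace_mult_scale_right)

lemma adj_map_adj_map:
  assumes "op_linear \<phi>"
  shows "adj_map (adj_map \<phi>) = \<phi>"
  by (rule adj_mapI[OF op_linear_adj_map[OF assms]])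
    (metis assms trace_adj_map trace_mul_sym)

lemma adj_map_comp:
  assumes "op_linear \<phi>" "op_linear \<psi>"
  shows "adj_map (\<phi> \<circ> \<psi>) = adj_map \<psi> \<circ> adj_map \<phi>"
  by (rule adj_mapI) (use assms in \<open>simp_all add: trace_adj_map op_linear_iff\<close>)

text \<open>The form of the image at \<open>v\<close> is the trace of \<open>A\<close> against
  \<open>\<phi>\<close> applied to the rank-one block operator of \<open>v\<close>, a pairing of two
  positive block operators. With \<open>k\<close> fixed, the case \<open>k = 1\<close> yields
  positivity and all \<open>k\<close> together yield complete positivity.\<close>

lemma positive_block_adj_map:
  assumes "op_linear \<phi>"
    and pos: "\<And>A. positive_block_op k A \<Longrightarrow> positive_block_op k (\<lambda>i j. \<phi> (A i j))"
    and A: "positive_block_op k A"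
  shows "positive_block_op k (\<lambda>i j. adj_map \<phi> (A i j))"
  unfolding positive_block_op_def
proof
  fix v
  have "(\<Sum>i<k. \<Sum>j<k. cinner (v i) (adj_map \<phi> (A i j) *v v j)) =
      (\<Sum>i<k. \<Sum>j<k. trace (A i j ** \<phi> (rank_one_op (v j) (v i))))"
    by (simp add: trace_mult_rank_one[symmetric] trace_adj_map[OF assms(1), symmetric]
        trace_mul_sym[of "adj_map _ _"] trace_mul_sym[of "\<phi> _"])
  then show "0 \<le> (\<Sum>i<k. \<Sum>j<k. cinner (v i) (adj_map \<phi> (A i j) *v v j))"
    using block_trace_mult_nonneg[OF A pos[OF positive_block_rank_one[of k v]]] by simp
qed

lemma positive_maps_linear: "\<phi> \<in> positive_maps \<Longrightarrow> op_linear \<phi>"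
  by (simp add: positive_maps_def)

lemma adj_map_positive_maps:
  assumes "\<phi> \<in> positive_maps"
  shows "adj_map \<phi> \<in> positive_maps"
proof -
  have "positive_op (adj_map \<phi> a)" if "positive_op a" for a
  proof -
    \<comment> \<open>The family \<open>A\<close> is arbitrary here, but for \<open>k = 1\<close>
      only the block \<open>A 0 0\<close> enters.\<close>
    have "positive_block_op 1 (\<lambda>i j. \<phi> (A i j))" if "positive_block_op 1 A" for A
    proof -
      have "positive_op (A 0 0)"
        using that unfolding positive_op_def positive_block_op_def
        by (auto dest: spec[of _ "\<lambda>_. v" for v])
      then have "positive_op (\<phi> (A 0 0))" using assms by (simp add: positive_maps_def)
      then show ?thesis by (simp add: positive_op_def positive_block_op_def)
    qed
    from positive_block_adj_map[OF positive_maps_linear[OF assms] this] that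
    show ?thesis by (simp add: positive_op_iff_block)
  qed
  then show ?thesis
    using assms by (simp add: positive_maps_def op_linear_adj_map)
qed

lemma adj_map_cp_maps: "\<phi> \<in> cp_maps \<Longrightarrow> adj_map \<phi> \<in> cp_maps"
  by (simp add: cp_maps_def op_linear_adj_map positive_block_adj_map)

lemma cp_maps_positive: "\<phi> \<in> cp_maps \<Longrightarrow> \<phi> \<in> positive_maps"
  by (auto simp: cp_maps_def positive_maps_def positive_op_iff_block)

lemma positive_maps_comp:
  "\<phi> \<in> positive_maps \<Longrightarrow> \<psi> \<in> positive_maps \<Longrightarrow> \<phi> \<circ> \<psi> \<in> positive_maps"
  by (simp add: positive_maps_def op_linear_iff)

lemma transpose_map_positive_maps:
  assumes "\<phi> \<in> positive_maps"
  shows "transpose_map \<phi> \<in> positive_maps"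
proof -
  have "transpose (a + b) = transpose a + transpose b"
    "transpose (op_scale c a) = op_scale c (transpose a)" for a b :: "'a op" and c
    by (simp_all add: transpose_def op_scale_def vec_eq_iff)
  then show ?thesis
    using assms
    by (simp add: positive_maps_def op_linear_iff transpose_map_def positive_op_transpose)
qed

lemma transpose_map_transpose_map: "transpose_map (transpose_map \<phi>) = \<phi>"
  by (simp add: transpose_map_def fun_eq_iff)

section \<open>The Choi pairing\<close>

lemma choi_matrix_nth: "choi_matrix \<phi> $ (i, k) $ (j, l) = \<phi> (matrix_unit i j) $ k $ l"
proof -
  have "choi_matrix \<phi> $ (i, k) $ (j, l) =
      (\<Sum>i'\<in>UNIV. \<Sum>j'\<in>UNIV. if j' = j then if i' = i then \<phi> (matrix_unit i' j') $ k $ l else 0 else 0)"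
    unfolding choi_matrix_def sum_component
    by (intro sum.cong refl) (simp add: tensor_op_def matrix_unit_def)
  then show ?thesis by simp
qed

lemma sum_UNIV_pair: "(\<Sum>p\<in>UNIV. f p) = (\<Sum>i\<in>UNIV. \<Sum>j\<in>UNIV. f (i, j))"
  by (simp add: sum.cartesian_product)

text \<open>In coordinates the pairing is a finite sum of products of entries, which serves
  continuity, the cone operations and the index permutation for adjoints.\<close>

lemma trace_choi_mult_nth:
  "trace (choi_matrix \<phi> ** choi_matrix \<psi>) =
    (\<Sum>i\<in>UNIV. \<Sum>j\<in>UNIV. \<Sum>k\<in>UNIV. \<Sum>l\<in>UNIV.
      \<phi> (matrix_unit i j) $ k $ l * \<psi> (matrix_unit j i) $ l $ k)"
proof -
  have "trace (choi_matrix \<phi> ** choi_matrix \<psi>) =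
    (\<Sum>i\<in>UNIV. \<Sum>k\<in>UNIV. \<Sum>j\<in>UNIV. \<Sum>l\<in>UNIV.
      \<phi> (matrix_unit i j) $ k $ l * \<psi> (matrix_unit j i) $ l $ k)"
    unfolding trace_mult sum_UNIV_pair choi_matrix_nth by (simp add: sum_UNIV_pair choi_matrix_nth)
  also have "\<dots> = (\<Sum>i\<in>UNIV. \<Sum>j\<in>UNIV. \<Sum>k\<in>UNIV. \<Sum>l\<in>UNIV.
      \<phi> (matrix_unit i j) $ k $ l * \<psi> (matrix_unit j i) $ l $ k)"
    by (intro sum.cong refl sum.swap)
  finally show ?thesis .
qed

lemma trace_choi_mult:
  "trace (choi_matrix \<phi> ** choi_matrix \<psi>) =
    (\<Sum>i\<in>UNIV. \<Sum>j\<in>UNIV. trace (\<phi> (matrix_unit i j) ** \<psi> (matrix_unit j i)))"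
  unfolding trace_choi_mult_nth by (simp add: trace_mult)

text \<open>The defining relation of the adjoint applies separately to each pair of matrix
  units.\<close>

lemma trace_choi_comp_left:
  assumes "op_linear \<alpha>"
  shows "trace (choi_matrix (\<alpha> \<circ> \<phi>) ** choi_matrix \<psi>) =
    trace (choi_matrix \<phi> ** choi_matrix (adj_map \<alpha> \<circ> \<psi>))"
  by (simp add: trace_choi_mult trace_adj_map[OF assms])

text \<open>An entry is a trace against a matrix unit, so both sides equal
  \<open>trace (\<phi> (matrix_unit l k) ** matrix_unit i j)\<close>.\<close>

lemma adj_map_matrix_unit_nth:
  assumes "op_linear \<phi>"
  shows "adj_map \<phi> (matrix_unit i j) $ k $ l = \<phi> (matrix_unit l k) $ j $ i"
  by (metis assms trace_adj_map trace_matrix_unit_mult trace_mul_sym)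

text \<open>Both pairings add up the same products \<open>?f\<close>; reversing the order of the
  four indices matches the terms.\<close>

lemma trace_choi_adj_map:
  assumes "op_linear \<phi>" "op_linear \<psi>"
  shows "trace (choi_matrix (adj_map \<phi>) ** choi_matrix \<psi>) =
    trace (choi_matrix \<phi> ** choi_matrix (adj_map \<psi>))"
proof -
  let ?f = "\<lambda>i j k l. \<phi> (matrix_unit i j) $ k $ l * \<psi> (matrix_unit k l) $ i $ j"
  have "trace (choi_matrix (adj_map \<phi>) ** choi_matrix \<psi>) =
      (\<Sum>(i, j, k, l)\<in>UNIV. ?f l k j i)"
    by (simp add: trace_choi_mult_nth adj_map_matrix_unit_nth assms sum.cartesian_product)
  also have "\<dots> = (\<Sum>(i, j, k, l)\<in>UNIV. ?f i j k l)"
    by (rule sum.reindex_bij_witness[of _ "\<lambda>(i, j, k, l). (l, k, j, i)" "\<lambda>(i, j, k, l). (l, k, j, i)"])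
      auto
  also have "\<dots> = trace (choi_matrix \<phi> ** choi_matrix (adj_map \<psi>))"
    by (simp add: trace_choi_mult_nth adj_map_matrix_unit_nth assms sum.cartesian_product)
  finally show ?thesis .
qed

lemma transpose_matrix_unit: "transpose (matrix_unit i j) = matrix_unit j i"
  by (auto simp: transpose_def matrix_unit_def vec_eq_iff)

text \<open>The outer transpose moves across the trace. The inner one exchanges the indices of the
  matrix units, which swapping the two sums undoes.\<close>

lemma trace_choi_transpose_map:
  "trace (choi_matrix (transpose_map \<phi>) ** choi_matrix \<psi>) =
    trace (choi_matrix \<phi> ** choi_matrix (transpose_map \<psi>))"
proof -
  have tr: "trace (transpose a ** b) = trace (a ** transpose b)" for a b :: "'a op"
    by (simp add: trace_mult transpose_def) (rule sum.swap)
  have "trace (choi_matrix (transpose_map \<phi>) ** choi_matrix \<psi>) =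
      (\<Sum>i\<in>UNIV. \<Sum>j\<in>UNIV. trace (\<phi> (matrix_unit j i) ** transpose (\<psi> (matrix_unit j i))))"
    by (simp add: trace_choi_mult transpose_map_def transpose_matrix_unit tr)
  also have "\<dots> = (\<Sum>j\<in>UNIV. \<Sum>i\<in>UNIV. trace (\<phi> (matrix_unit j i) ** transpose (\<psi> (matrix_unit j i))))"
    by (rule sum.swap)
  also have "\<dots> = trace (choi_matrix \<phi> ** choi_matrix (transpose_map \<psi>))"
    by (simp add: trace_choi_mult transpose_map_def transpose_matrix_unit)
  finally show ?thesis .
qed

section \<open>The dual cone\<close>

lemma continuous_on_map_nth: "continuous_on UNIV (\<lambda>\<phi>::'a \<Rightarrow> complex ^ 'n ^ 'm. \<phi> a $ i $ j)"
  by (intro continuous_on_component continuous_on_product_coordinates)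

lemma closed_Collect_nonneg_complex:
  fixes f :: "'a::topological_space \<Rightarrow> complex"
  assumes "continuous_on UNIV f"
  shows "closed {x. 0 \<le> f x}"
proof -
  have "{x. 0 \<le> f x} = {x. 0 \<le> Re (f x)} \<inter> {x. 0 = Im (f x)}"
    by (auto simp: less_eq_complex_def)
  then show ?thesis
    by (simp add: closed_Int closed_Collect_le closed_Collect_eq assms continuous_on_Re continuous_on_Im
        continuous_on_const)
qed

text \<open>The ambient space consists of all functions, so linearity too must survive pointwise
  limits. For fixed arguments each condition involves only finitely many values of the map.\<close>

lemma closed_positive_maps: "closed (positive_maps :: ('n::finite op \<Rightarrow> 'n op) set)"
proof -
  have 1: "closed {\<phi> :: 'n op \<Rightarrow> 'n op. \<phi> (a + b) = \<phi> a + \<phi> b}" for a b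
    by (intro closed_Collect_eq continuous_intros continuous_on_product_coordinates)
  have 2: "closed {\<phi> :: 'n op \<Rightarrow> 'n op. \<phi> (op_scale c a) = op_scale c (\<phi> a)}" for c a
    unfolding op_scale_def
    by (intro closed_Collect_eq continuous_on_product_coordinates continuous_on_vec_lambda
        continuous_intros continuous_on_map_nth)
  have 3: "closed {\<phi> :: 'n op \<Rightarrow> 'n op. positive_op a \<longrightarrow> positive_op (\<phi> a)}" for a
    unfolding positive_op_def cinner_matrix_vector
    by (intro closed_Collect_imp open_Collect_const closed_Collect_all closed_Collect_nonneg_complex
        continuous_intros continuous_on_map_nth)
  show ?thesis
    unfolding positive_maps_def op_linear_iff
    by (intro closed_Collect_conj closed_Collect_all 1 2 3)
qed

lemma closed_dual_cone: "closed (dual_cone K)"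
proof -
  have "closed {\<phi>. \<alpha> \<in> K \<longrightarrow> 0 \<le> trace (choi_matrix \<phi> ** choi_matrix \<alpha>)}" for \<alpha>
    unfolding trace_choi_mult_nth
    by (intro closed_Collect_imp open_Collect_const closed_Collect_nonneg_complex
        continuous_intros continuous_on_map_nth)
  then show ?thesis
    unfolding dual_cone_def Ball_def
    by (intro closed_Collect_conj closed_Collect_all) (simp_all add: closed_positive_maps)
qed

lemma closed_subcone_dual_cone:
  fixes K :: "('n::finite op \<Rightarrow> 'n op) set"
  shows "closed_subcone (dual_cone K)"
  unfolding closed_subcone_def
proof (intro conjI ballI allI impI)
  show "dual_cone K \<subseteq> positive_maps" by (auto simp: dual_cone_def)
  show "closed (dual_cone K)" by (rule closed_dual_cone)
next
  fix \<phi> \<psi> assume "\<phi> \<in> dual_cone K" "\<psi> \<in> dual_cone K"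
  then show "(\<lambda>a. \<phi> a + \<psi> a) \<in> dual_cone K"
    by (auto simp: dual_cone_def trace_choi_mult_nth positive_maps_def op_linear_iff positive_op_def
        cinner_matrix_vector distrib_left distrib_right sum.distrib op_scale_def vec_eq_iff)
next
  fix \<phi> and c :: real assume \<phi>: "\<phi> \<in> dual_cone K" and c: "0 \<le> c"
  have scale: "cinner v ((c *\<^sub>R A) *v v) = of_real c * cinner v (A *v v)"
    for v and A :: "'n op"
    by (simp add: cinner_matrix_vector sum_distrib_left scaleR_conv_of_real[where 'a=complex] mult_ac)
  have "positive_op (c *\<^sub>R A)" if "positive_op A" for A :: "'n op"
    using that c by (auto simp: positive_op_def scale less_eq_complex_def)
  moreover have "trace (choi_matrix (\<lambda>a. c *\<^sub>R \<phi> a) ** choi_matrix \<alpha>) =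
      of_real c * trace (choi_matrix \<phi> ** choi_matrix \<alpha>)" for \<alpha>
    by (simp add: trace_choi_mult_nth sum_distrib_left scaleR_conv_of_real[where 'a=complex] mult_ac)
  moreover have "0 \<le> complex_of_real c" using c by (simp add: less_eq_complex_def)
  ultimately show "(\<lambda>a. c *\<^sub>R \<phi> a) \<in> dual_cone K"
    using \<phi> by (auto simp: dual_cone_def positive_maps_def op_linear_iff
        op_scale_def vec_eq_iff scaleR_right_distrib)
qed

lemma trace_map_in_dual_cone:
  fixes K :: "('n::finite op \<Rightarrow> 'n op) set"
  assumes "K \<subseteq> positive_maps"
  shows "(\<lambda>a. op_scale (trace a) (mat 1)) \<in> dual_cone K"
proof -
  let ?\<tau> = "\<lambda>a::'n op. op_scale (trace a) (mat 1) :: 'n op"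
  have "op_linear ?\<tau>"
    by (simp add: op_linear_iff op_scale_def trace_def vec_eq_iff sum.distrib sum_distrib_left algebra_simps)
  moreover have "positive_op (?\<tau> a)" if "positive_op a" for a
  proof -
    have "cinner v (?\<tau> a *v v) = trace a * cinner v (mat 1 *v v)" for v
      unfolding cinner_matrix_vector by (simp add: op_scale_def sum_distrib_left mult_ac)
    then show ?thesis
      using trace_nonneg[OF that] positive_op_mat[where 'a='n]
      by (simp add: positive_op_def)
  qed
  moreover have "0 \<le> trace (choi_matrix ?\<tau> ** choi_matrix \<alpha>)" if "\<alpha> \<in> K" for \<alpha>
  proof -
    have \<alpha>: "\<alpha> \<in> positive_maps" using that assms by auto
    have "trace (matrix_unit i j :: 'n op) = (if i = j then 1 else 0)" for i j
      using trace_matrix_unit_mult[of i j "mat 1"] by (simp add: matrix_mul_rid) (simp add: mat_def)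
    \<comment> \<open>Thus the Choi matrix of \<open>?\<tau>\<close> is the identity, and only the
      diagonal matrix units, which are positive, remain in the pairing.\<close>
    then have "?\<tau> (matrix_unit i j) = (if i = j then mat 1 else 0)" for i j
      by (simp add: op_scale_def vec_eq_iff)
    moreover have "trace (0 :: 'n op) = 0" by (simp add: trace_def)
    ultimately have "trace (choi_matrix ?\<tau> ** choi_matrix \<alpha>) = (\<Sum>i\<in>UNIV. trace (\<alpha> (matrix_unit i i)))"
      by (simp add: trace_choi_mult if_distrib[of "\<lambda>x. x ** _"] if_distrib[of trace] cong: if_cong)
    also have "0 \<le> \<dots>"
    proof (intro sum_nonneg trace_nonneg)
      fix i :: 'n
      have "matrix_unit i i = rank_one_op (axis i 1) (axis i 1)"
        by (auto simp: matrix_unit_def rank_one_op_def axis_def vec_eq_iff)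
      then have "positive_op (matrix_unit i i)"
        using positive_block_rank_one[of 1 "\<lambda>_. axis i 1"] by (simp add: positive_op_iff_block)
      then show "positive_op (\<alpha> (matrix_unit i i))" using \<alpha> by (simp add: positive_maps_def)
    qed
    finally show ?thesis .
  qed
  ultimately show ?thesis by (simp add: dual_cone_def positive_maps_def)
qed

theorem theorem1:
  fixes K :: "(complex ^ 'n::finite ^ 'n \<Rightarrow> complex ^ 'n ^ 'n) set"
  assumes "symmetric_mapping_cone K"
  shows "symmetric_mapping_cone (dual_cone K)"
proof -
  note sym = assms[unfolded symmetric_mapping_cone_def mapping_cone_def closed_subcone_def]
  have Kpos: "K \<subseteq> positive_maps" using sym by blast
  have K_lin: "op_linear \<psi>" if "\<psi> \<in> K" for \<psi> using Kpos that positive_maps_linear by blast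
  have K_comp: "\<alpha> \<circ> \<psi> \<in> K" if "\<psi> \<in> K" "\<alpha> \<in> cp_maps" for \<psi> \<alpha>
    using sym that by blast
  have K_adj: "adj_map \<psi> \<in> K" and K_transpose: "transpose_map \<psi> \<in> K" if "\<psi> \<in> K" for \<psi>
    using sym that by blast+
  have lin: "op_linear \<phi>" if "\<phi> \<in> dual_cone K" for \<phi>
    using that by (simp add: dual_cone_def positive_maps_def)
  have adj: "adj_map \<phi> \<in> dual_cone K" if "\<phi> \<in> dual_cone K" for \<phi>
    using that K_adj
    by (auto simp: dual_cone_def adj_map_positive_maps trace_choi_adj_map K_lin positive_maps_linear)
  have transp: "transpose_map \<phi> \<in> dual_cone K" if "\<phi> \<in> dual_cone K" for \<phi>
    using that K_transpose
    by (auto simp: dual_cone_def transpose_map_positive_maps trace_choi_transpose_map)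
  have comp_left: "\<alpha> \<circ> \<phi> \<in> dual_cone K" if "\<phi> \<in> dual_cone K" "\<alpha> \<in> cp_maps" for \<phi> \<alpha>
    using that K_comp[OF _ adj_map_cp_maps[OF that(2)]] cp_maps_positive[OF that(2)]
    by (auto simp: dual_cone_def positive_maps_comp trace_choi_comp_left positive_maps_linear)
  have comp_right: "\<phi> \<circ> \<beta> \<in> dual_cone K" if "\<phi> \<in> dual_cone K" "\<beta> \<in> cp_maps" for \<phi> \<beta>
  proof -
    note l = lin[OF that(1)] positive_maps_linear[OF cp_maps_positive[OF that(2)]]
    have "adj_map (adj_map \<beta> \<circ> adj_map \<phi>) = \<phi> \<circ> \<beta>"
      using l by (simp add: adj_map_comp op_linear_adj_map adj_map_adj_map)
    then show ?thesis
      using adj[OF comp_left[OF adj[OF that(1)] adj_map_cp_maps[OF that(2)]]] by simp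
  qed
  \<comment> \<open>The trace map is tested at the identity, whose trace is the dimension of H and
    hence nonzero.\<close>
  have "op_scale (trace (mat 1)) (mat 1) \<noteq> (0 :: 'n op)"
    by (auto simp: op_scale_def trace_def mat_def vec_eq_iff)
  then have "\<exists>\<phi>\<in>dual_cone K. \<phi> \<noteq> (\<lambda>a. 0)"
    using trace_map_in_dual_cone[OF Kpos] by metis
  then have "mapping_cone (dual_cone K)"
    using comp_left comp_right closed_subcone_dual_cone by (auto simp: mapping_cone_def)
  \<comment> \<open>Taking adjoints is an involution on positive maps, so the one-sided closure
    \<open>adj\<close> also gives the converse; transposition is treated alike.\<close>
  moreover have "\<phi> \<in> dual_cone K \<longleftrightarrow> adj_map \<phi> \<in> dual_cone K" if "\<phi> \<in> positive_maps" for \<phi>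
    using adj[of \<phi>] adj[of "adj_map \<phi>"] adj_map_adj_map[OF positive_maps_linear[OF that]] by auto
  moreover have "\<phi> \<in> dual_cone K \<longleftrightarrow> transpose_map \<phi> \<in> dual_cone K" for \<phi>
    using transp[of \<phi>] transp[of "transpose_map \<phi>"] by (auto simp: transpose_map_transpose_map)
  ultimately show ?thesis by (simp add: symmetric_mapping_cone_def)
qed

end
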